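(* Let $1\le p<\infty$ and let $X$ be a Banach space. Suppose there exist a Banach space $Z$ and a compact, dual $p$-persistent operator $T\in B(Z,X)$ such that $T^*\in\Pi_p(X^*,Z^* )$. Then $H_{w^*}^{p}[X]\supsetneq\overline{I}_{w^*}^{p}[X]\supsetneq I_{w^*}^{p}[X]$.
   Context: All Banach spaces are real. $B(Z,X)$ is the space of bounded linear operators; $\Pi_p$ is the ideal of $p$-summing operators with norm $\pi_p$, and $\pi_p(S)=\infty$ if $S$ is not $p$-summing. Let $1/p+1/p'=1$. For $z_1,\dots,z_n$ in a Banach space, $\|(z_i)_{i=1}^n\|_{p,\mathrm{weak}}=\sup\{\|\sum_i\alpha_i z_i\| : \|(\alpha_i)_i\|_{\ell_{p'}}\le 1\}$. For a Banach space $X$, $H_{w^*}[X]$ is the vector lattice (pointwise operations and order) of positively homogeneous functions $f:X^*\to\mathbb R$ that are weak$^*$-continuous on bounded sets. For $f\in H_{w^*}[X]$, $\|f\|_p$ is the infimum of all $C\ge 0$ such that $(\sum_{i=1}^n|f(x_i^* )|^p)^{1/p}\le C\|(x_i^* )_{i=1}^n\|_{p,\mathrm{weak}}$ for all $n$ and all $x_1^*,\dots,x_n^*\in X^*$. $H_{w^*}^p[X]=\{f\in H_{w^*}[X]:\|f\|_p<\infty\}$, normed by $\|\cdot\|_p$. For $x\in X$, $\delta_x(x^* )=\langle x^*,x\rangle$. $\mathrm{FVL}[X]$ is the vector sublattice of $H_{w^*}[X]$ generated by $\{\delta_x:x\in X\}$; $\mathrm{FBL}^{(p)}[X]$ is the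 closure of $\mathrm{FVL}[X]$ in $H_{w^*}^p[X]$; $I_{w^*}^p[X]$ is the (order) ideal of $H_{w^*}[X]$ generated by $\mathrm{FBL}^{(p)}[X]$; $\overline{I}_{w^*}^p[X]$ is the closure of $I_{w^*}^p[X]$ in $H_{w^*}^p[X]$. $T\in B(Z,X)$ is dual $p$-persistent relative to a dense set $X_0\subset X$ if there is $c>0$ such that $\pi_p\big(T^*|_{\bigcap_i x_i^\perp}\big)>c$ for all finite collections $x_1,\dots,x_n\in X_0$, where $x_i^\perp=\{x^*\in X^*:\langle x^*,x_i\rangle=0\}$. $T$ is dual $p$-persistent if this holds for some dense $X_0\subset X$. *)

theory Defs
  imports "HOL-Analysis.Analysis"
begin

section \<open>Weak \<open>p\<close>-norms of finite families\<close>

text \<open>A finite family \<open>z\<^sub>1, \<dots>, z\<^sub>n\<close> is represented by a function \<open>z\<close> on \<^typ>\<open>nat\<close>, of which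
  only the values at indices \<open>i < n\<close> matter.\<close>

definition conj_exponent :: "real \<Rightarrow> ereal" where
  "conj_exponent p = (if p = 1 then \<infinity> else ereal (p / (p - 1)))"

lemma conj_exponent:
  assumes "1 \<le> p"
  shows "1 / ereal p + 1 / conj_exponent p = 1"
  using assms by (auto simp: conj_exponent_def divide_ereal_def one_ereal_def divide_simps)

text \<open>The \<open>0\<close> in the maximum only serves to give the right value for the empty family.\<close>

definition lq_norm :: "ereal \<Rightarrow> nat \<Rightarrow> (nat \<Rightarrow> real) \<Rightarrow> real" where
  "lq_norm q n a =
     (if q = \<infinity> then Max (insert 0 ((\<lambda>i. \<bar>a i\<bar>) ` {..<n}))
      else (\<Sum>i<n. \<bar>a i\<bar> powr real_of_ereal q) powr (1 / real_of_ereal q))"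

definition weak_norm :: "real \<Rightarrow> nat \<Rightarrow> (nat \<Rightarrow> 'a::real_normed_vector) \<Rightarrow> real" where
  "weak_norm p n z =
     (SUP \<alpha>\<in>{\<alpha>. lq_norm (conj_exponent p) n \<alpha> \<le> 1}. norm (\<Sum>i<n. \<alpha> i *\<^sub>R z i))"

lemma abs_le_lq_norm:
  assumes "q = \<infinity> \<or> (\<exists>r>0. q = ereal r)" "i < n"
  shows "\<bar>a i\<bar> \<le> lq_norm q n a"
proof (cases "q = \<infinity>")
  case True
  then show ?thesis using assms(2) by (auto simp: lq_norm_def intro!: Max_ge)
next
  case False
  then obtain r where r: "r > 0" "q = ereal r" using assms(1) by auto
  have "\<bar>a i\<bar> powr r \<le> (\<Sum>j<n. \<bar>a j\<bar> powr r)"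
    using assms(2) by (intro member_le_sum) auto
  then have "(\<bar>a i\<bar> powr r) powr (1 / r) \<le> (\<Sum>j<n. \<bar>a j\<bar> powr r) powr (1 / r)"
    using r by (intro powr_mono2) auto
  then show ?thesis using r by (simp add: lq_norm_def powr_powr)
qed

text \<open>The supremum in \<^const>\<open>weak_norm\<close> is a genuine one.\<close>

lemma bdd_above_weak_norm:
  fixes z :: "nat \<Rightarrow> 'a::real_normed_vector"
  assumes "1 \<le> p"
  shows "bdd_above ((\<lambda>\<alpha>. norm (\<Sum>i<n. \<alpha> i *\<^sub>R z i)) `
    {\<alpha>. lq_norm (conj_exponent p) n \<alpha> \<le> 1})"
proof (rule bdd_aboveI2)
  fix \<alpha> assume a: "\<alpha> \<in> {\<alpha>. lq_norm (conj_exponent p) n \<alpha> \<le> 1}"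
  have q: "conj_exponent p = \<infinity> \<or> (\<exists>r>0. conj_exponent p = ereal r)"
    using assms by (auto simp: conj_exponent_def)
  have "\<bar>\<alpha> i\<bar> \<le> 1" if "i < n" for i
    using abs_le_lq_norm[OF q that, of \<alpha>] a by simp
  then have "norm (\<alpha> i *\<^sub>R z i) \<le> norm (z i)" if "i < n" for i
    using that by (simp add: mult_left_le_one_le)
  then show "norm (\<Sum>i<n. \<alpha> i *\<^sub>R z i) \<le> (\<Sum>i<n. norm (z i))"
    by (intro order_trans[OF norm_sum] sum_mono) auto
qed


section \<open>Operators\<close>

lift_definition dual_operator ::
  "('z::real_normed_vector \<Rightarrow>\<^sub>L 'x::real_normed_vector) \<Rightarrow> ('x \<Rightarrow>\<^sub>L real) \<Rightarrow>\<^sub>L ('z \<Rightarrow>\<^sub>L real)"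
  is "\<lambda>T x'. x' o\<^sub>L T"
  by (rule bounded_bilinear.bounded_linear_left[OF bounded_bilinear_blinfun_compose])

text \<open>\<open>pi_summing p V S\<close> is \<open>\<pi>\<^sub>p\<close> of the restriction of \<open>S\<close> to the subspace \<open>V\<close>; the weak norm
  of a family in \<open>V\<close> does not depend on whether it is taken in \<open>V\<close> or in the whole space. The
  infimum of the empty set is \<open>\<infinity>\<close>.\<close>

definition pi_summing ::
  "real \<Rightarrow> 'a::real_normed_vector set \<Rightarrow> ('a \<Rightarrow>\<^sub>L 'b::real_normed_vector) \<Rightarrow> ennreal" where
  "pi_summing p V S =
     (INF C\<in>{C::real. 0 \<le> C \<and>
        (\<forall>n x. (\<forall>i<n. x i \<in> V) \<longrightarrow>
           (\<Sum>i<n. norm (S (x i)) powr p) powr (1 / p) \<le> C * weak_norm p n x)}. ennreal C)"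

definition p_summing :: "real \<Rightarrow> ('a::real_normed_vector \<Rightarrow>\<^sub>L 'b::real_normed_vector) \<Rightarrow> bool" where
  "p_summing p S \<longleftrightarrow> pi_summing p UNIV S < \<infinity>"

definition compact_operator :: "('z::real_normed_vector \<Rightarrow>\<^sub>L 'x::real_normed_vector) \<Rightarrow> bool" where
  "compact_operator T \<longleftrightarrow> compact (closure (blinfun_apply T ` cball 0 1))"

definition annihilator :: "'x::real_normed_vector \<Rightarrow> ('x \<Rightarrow>\<^sub>L real) set" where
  "annihilator x = {x'. blinfun_apply x' x = 0}"

definition dual_persistent_rel ::
  "real \<Rightarrow> 'x::real_normed_vector set \<Rightarrow> ('z::real_normed_vector \<Rightarrow>\<^sub>L 'x) \<Rightarrow> bool" where
  "dual_persistent_rel p X0 T \<longleftrightarrow>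
     (\<exists>c::real. c > 0 \<and>
        (\<forall>F. finite F \<and> F \<subseteq> X0 \<longrightarrow> pi_summing p (\<Inter>x\<in>F. annihilator x) (dual_operator T) > ennreal c))"

definition dual_persistent ::
  "real \<Rightarrow> ('z::real_normed_vector \<Rightarrow>\<^sub>L 'x::real_normed_vector) \<Rightarrow> bool" where
  "dual_persistent p T \<longleftrightarrow> (\<exists>X0. closure X0 = UNIV \<and> dual_persistent_rel p X0 T)"


section \<open>Lattices of positively homogeneous functions on the dual\<close>

type_synonym 'x dual_fun = "('x \<Rightarrow>\<^sub>L real) \<Rightarrow> real"

text \<open>For operators into \<open>\<real>\<close>, the strong operator topology is the topology of pointwise convergence
  on \<open>X\<close>, that is, the weak-star topology of \<open>X\<^sup>*\<close>.\<close>

definition Hw :: "'x::real_normed_vector dual_fun set" where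
  "Hw = {f. (\<forall>t\<ge>0. \<forall>x'. f (t *\<^sub>R x') = t * f x') \<and>
            (\<forall>B. bounded B \<longrightarrow>
               continuous_map (subtopology strong_operator_topology B) euclideanreal f)}"

definition Hnorm :: "real \<Rightarrow> 'x::real_normed_vector dual_fun \<Rightarrow> ennreal" where
  "Hnorm p f =
     (INF C\<in>{C::real. 0 \<le> C \<and>
        (\<forall>n x'. (\<Sum>i<n. \<bar>f (x' i)\<bar> powr p) powr (1 / p) \<le> C * weak_norm p n x')}. ennreal C)"

definition Hwp :: "real \<Rightarrow> 'x::real_normed_vector dual_fun set" where
  "Hwp p = {f \<in> Hw. Hnorm p f < \<infinity>}"

definition Hwp_closure ::
  "real \<Rightarrow> 'x::real_normed_vector dual_fun set \<Rightarrow> 'x dual_fun set" where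
  "Hwp_closure p A =
     {f \<in> Hwp p. \<forall>e>0. \<exists>g\<in>A \<inter> Hwp p. Hnorm p (\<lambda>x'. f x' - g x') < ennreal e}"

definition linear_subspace_Hw :: "'x::real_normed_vector dual_fun set \<Rightarrow> bool" where
  "linear_subspace_Hw L \<longleftrightarrow> L \<subseteq> Hw \<and> (\<lambda>x'. 0) \<in> L \<and>
     (\<forall>f\<in>L. \<forall>g\<in>L. (\<lambda>x'. f x' + g x') \<in> L) \<and>
     (\<forall>c. \<forall>f\<in>L. (\<lambda>x'. c * f x') \<in> L)"

definition vector_sublattice_Hw :: "'x::real_normed_vector dual_fun set \<Rightarrow> bool" where
  "vector_sublattice_Hw L \<longleftrightarrow> linear_subspace_Hw L \<and>
     (\<forall>f\<in>L. \<forall>g\<in>L. (\<lambda>x'. max (f x') (g x')) \<in> L \<and> (\<lambda>x'. min (f x') (g x')) \<in> L)"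

definition order_ideal_Hw :: "'x::real_normed_vector dual_fun set \<Rightarrow> bool" where
  "order_ideal_Hw L \<longleftrightarrow> linear_subspace_Hw L \<and>
     (\<forall>g\<in>L. \<forall>f\<in>Hw. (\<forall>x'. \<bar>f x'\<bar> \<le> \<bar>g x'\<bar>) \<longrightarrow> f \<in> L)"

definition evaluation :: "'x::real_normed_vector \<Rightarrow> 'x dual_fun" where
  "evaluation x = (\<lambda>x'. blinfun_apply x' x)"

definition FVL :: "'x::real_normed_vector dual_fun set" where
  "FVL = vector_sublattice_Hw hull range evaluation"

definition FBL :: "real \<Rightarrow> 'x::real_normed_vector dual_fun set" where
  "FBL p = Hwp_closure p FVL"

definition Iw :: "real \<Rightarrow> 'x::real_normed_vector dual_fun set" where
  "Iw p = order_ideal_Hw hull FBL p"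

definition Iw_closure :: "real \<Rightarrow> 'x::real_normed_vector dual_fun set" where
  "Iw_closure p = Hwp_closure p (Iw p)"

end

theory Submission
  imports Defs
begin

text \<open>Write \<open>f\<^sub>T x' = \<parallel>T\<^sup>* x'\<parallel>\<close>; compactness of \<open>T\<close> makes \<open>f\<^sub>T\<close> weak-star continuous on bounded sets, and
  summability of \<open>T\<^sup>*\<close> gives \<open>\<parallel>f\<^sub>T\<parallel>\<^sub>p < \<infinity>\<close>. An element of \<open>FBL\<close> is a norm limit of functions of
  finitely many evaluations, and by density these may be taken at points of \<open>X\<^sub>0\<close>, up to a small error.
  Hence on a family \<open>s\<^sub>i w + v\<^sub>i\<close>, with \<open>w\<close> fixed and all \<open>v\<^sub>i\<close> in the annihilator of a suitable finite
  subset of \<open>X\<^sub>0\<close>, it differs little from its values at \<open>s\<^sub>i w\<close>, so that any \<open>f\<close> in the ideal satisfies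
  \<open>(\<Sum>\<bar>f (s\<^sub>i w + v\<^sub>i)\<bar>\<^sup>p)\<^bsup>1/p\<^esup> \<le> \<epsilon> \<parallel>v\<parallel>\<^bsub>p,weak\<^esub> + M \<parallel>s\<parallel>\<^sub>p\<close> with \<open>M\<close> independent of \<open>\<epsilon>\<close>.
  Taking \<open>s = 0\<close>, persistence of \<open>T\<close> keeps \<open>f\<^sub>T\<close> away from the ideal. For the second inclusion,
  the geometric mean \<open>f = (f\<^sub>T \<bar>\<delta>\<^sub>x\<bar>)\<^bsup>1/2\<^esup>\<close> is in the closure of the ideal, because it is at most
  \<open>(\<eta> f\<^sub>T + \<bar>\<delta>\<^sub>x\<bar> / \<eta>) / 2\<close> for all \<open>\<eta> > 0\<close>. It is not in the ideal: for \<open>s\<^sub>i = t \<parallel>T\<^sup>* v\<^sub>i\<parallel>\<close> the left-hand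
  side above is of order \<open>t\<^bsup>1/2\<^esup>\<close>, while the right-hand side is of order \<open>t\<close>.\<close>

section \<open>Strong and weak p-norms\<close>

abbreviation lp_norm :: "real \<Rightarrow> nat \<Rightarrow> (nat \<Rightarrow> real) \<Rightarrow> real" where
  "lp_norm p \<equiv> lq_norm (ereal p)"

lemma lp_norm_eq: "lp_norm p n a = (\<Sum>i<n. \<bar>a i\<bar> powr p) powr (1 / p)"
  by (simp add: lq_norm_def)

lemma lp_norm_nonneg: "0 \<le> lp_norm p n a"
  by (simp add: lp_norm_eq)

lemma lp_norm_powr: "p \<noteq> 0 \<Longrightarrow> lp_norm p n a powr p = (\<Sum>i<n. \<bar>a i\<bar> powr p)"
  by (simp add: lp_norm_eq powr_powr sum_nonneg)

lemma lq_norm_zero: "lq_norm q n (\<lambda>i. 0) = 0"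
proof (cases "n = 0")
  case False
  then have "(\<lambda>i. 0 :: real) ` {..<n} = {0}" by auto
  then show ?thesis by (simp add: lq_norm_def)
qed (simp add: lq_norm_def)

lemma lq_norm_infinity_le_iff:
  assumes "0 \<le> c"
  shows "lq_norm \<infinity> n a \<le> c \<longleftrightarrow> (\<forall>i<n. \<bar>a i\<bar> \<le> c)"
  using assms by (auto simp: lq_norm_def)

lemma conj_exponent_gt_1:
  assumes "1 < p"
  defines "q \<equiv> p / (p - 1)"
  shows "conj_exponent p = ereal q" "1 < q" "1 / p + 1 / q = 1" "(p - 1) * q = p"
  using assms by (auto simp: conj_exponent_def divide_simps)

context
  fixes p :: real
  assumes p: "1 \<le> p"
begin

lemma lp_norm_mono:
  assumes "\<And>i. i < n \<Longrightarrow> \<bar>a i\<bar> \<le> \<bar>b i\<bar>"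
  shows "lp_norm p n a \<le> lp_norm p n b"
  using p assms by (auto simp: lp_norm_eq intro!: powr_mono2 sum_mono sum_nonneg)

lemma lp_norm_scale: "lp_norm p n (\<lambda>i. c * a i) = \<bar>c\<bar> * lp_norm p n a"
  using p by (simp add: lp_norm_eq abs_mult powr_mult sum_nonneg powr_powr
      flip: sum_distrib_left)

lemma weak_norm_upper:
  assumes "lq_norm (conj_exponent p) n \<alpha> \<le> 1"
  shows "norm (\<Sum>i<n. \<alpha> i *\<^sub>R z i) \<le> weak_norm p n z"
  unfolding weak_norm_def
  by (rule cSUP_upper[OF _ bdd_above_weak_norm[OF p]]) (use assms in auto)

lemma weak_norm_least:
  assumes "\<And>\<alpha>. lq_norm (conj_exponent p) n \<alpha> \<le> 1 \<Longrightarrow> norm (\<Sum>i<n. \<alpha> i *\<^sub>R z i) \<le> c"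
  shows "weak_norm p n z \<le> c"
  unfolding weak_norm_def
proof (rule cSUP_least)
  have "lq_norm (conj_exponent p) n (\<lambda>i. 0) \<le> 1" by (simp add: lq_norm_zero)
  then show "{\<alpha>. lq_norm (conj_exponent p) n \<alpha> \<le> 1} \<noteq> {}" by blast
qed (use assms in auto)

lemma weak_norm_nonneg: "0 \<le> weak_norm p n z"
  using weak_norm_upper[of n "\<lambda>i. 0" z] by (simp add: lq_norm_zero)

lemma weak_norm_triangle:
  "weak_norm p n (\<lambda>i. y i + z i) \<le> weak_norm p n y + weak_norm p n z"
proof (rule weak_norm_least)
  fix \<alpha> assume a: "lq_norm (conj_exponent p) n \<alpha> \<le> 1"
  have "norm (\<Sum>i<n. \<alpha> i *\<^sub>R (y i + z i)) \<le> norm (\<Sum>i<n. \<alpha> i *\<^sub>R y i) + norm (\<Sum>i<n. \<alpha> i *\<^sub>R z i)"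
    by (simp add: algebra_simps sum.distrib norm_triangle_ineq)
  also have "\<dots> \<le> weak_norm p n y + weak_norm p n z"
    by (intro add_mono weak_norm_upper a)
  finally show "norm (\<Sum>i<n. \<alpha> i *\<^sub>R (y i + z i)) \<le> weak_norm p n y + weak_norm p n z" .
qed

lemma weak_norm_bounded_linear:
  assumes "bounded_linear L" "\<And>x. norm (L x) \<le> norm x * K" "0 \<le> K"
  shows "weak_norm p n (\<lambda>i. L (z i)) \<le> weak_norm p n z * K"
proof (rule weak_norm_least)
  fix \<alpha> assume a: "lq_norm (conj_exponent p) n \<alpha> \<le> 1"
  interpret bounded_linear L by fact
  have "norm (\<Sum>i<n. \<alpha> i *\<^sub>R L (z i)) = norm (L (\<Sum>i<n. \<alpha> i *\<^sub>R z i))"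
    by (simp add: sum scaleR)
  also have "\<dots> \<le> norm (\<Sum>i<n. \<alpha> i *\<^sub>R z i) * K" by (rule assms)
  also have "\<dots> \<le> weak_norm p n z * K"
    by (intro mult_right_mono weak_norm_upper a assms)
  finally show "norm (\<Sum>i<n. \<alpha> i *\<^sub>R L (z i)) \<le> weak_norm p n z * K" .
qed

text \<open>For p > 1, normalise \<open>a\<close> to norm 1 and sum Young's inequality over the
  indices. The case p = 1 is separate because the conjugate exponent is then infinite.\<close>

lemma Hoelder_lq_norm:
  assumes "lq_norm (conj_exponent p) n \<alpha> \<le> 1"
  shows "\<bar>\<Sum>i<n. \<alpha> i * a i\<bar> \<le> lp_norm p n a"
proof (cases "p = 1")
  case True
  have "\<bar>\<Sum>i<n. \<alpha> i * a i\<bar> \<le> (\<Sum>i<n. \<bar>\<alpha> i\<bar> * \<bar>a i\<bar>)"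
    by (rule order_trans[OF sum_abs]) (simp add: abs_mult)
  also have "\<dots> \<le> (\<Sum>i<n. \<bar>a i\<bar>)"
    using assms True
    by (intro sum_mono mult_left_le_one_le) (auto simp: conj_exponent_def lq_norm_infinity_le_iff)
  finally show ?thesis by (simp add: True lp_norm_eq sum_nonneg)
next
  case False
  then have p1: "1 < p" using p by simp
  define q where "q = p / (p - 1)"
  note q = conj_exponent_gt_1[OF p1, folded q_def]
  define A where "A = lp_norm p n a"
  show ?thesis
  proof (cases "A = 0")
    case True
    then have "(\<Sum>i<n. \<bar>a i\<bar> powr p) = 0" using p1 by (simp add: A_def lp_norm_eq)
    then have "\<forall>i<n. a i = 0" by (subst (asm) sum_nonneg_eq_0_iff) auto
    then show ?thesis by (simp add: lp_norm_nonneg)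
  next
    case False
    then have A: "A > 0" using lp_norm_nonneg[of p n a] by (simp add: A_def)
    have "(\<Sum>i<n. \<bar>\<alpha> i\<bar> powr q) \<le> 1"
    proof -
      have "lp_norm q n \<alpha> \<le> 1" using assms q by simp
      then have "lp_norm q n \<alpha> powr q \<le> 1 powr q"
        using q by (intro powr_mono2) (auto simp: lp_norm_nonneg)
      then show ?thesis using q by (simp add: lp_norm_powr)
    qed
    moreover have "(\<Sum>i<n. (\<bar>a i\<bar> / A) powr p) = 1"
    proof -
      have "(\<Sum>i<n. (\<bar>a i\<bar> / A) powr p) = (\<Sum>i<n. \<bar>a i\<bar> powr p) / A powr p"
        using A by (simp add: powr_divide sum_divide_distrib)
      also have "\<dots> = 1" using A p1 by (simp add: A_def flip: lp_norm_powr)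
      finally show ?thesis .
    qed
    moreover have "(\<Sum>i<n. \<bar>\<alpha> i\<bar> * (\<bar>a i\<bar> / A)) \<le> (\<Sum>i<n. \<bar>\<alpha> i\<bar> powr q / q + (\<bar>a i\<bar> / A) powr p / p)"
      using p1 q A by (intro sum_mono Youngs_inequality) auto
    ultimately have "(\<Sum>i<n. \<bar>\<alpha> i\<bar> * (\<bar>a i\<bar> / A)) \<le> 1 / q + 1 / p"
      using q divide_right_mono[of "\<Sum>i<n. \<bar>\<alpha> i\<bar> powr q" 1 q]
      by (simp add: sum.distrib flip: sum_divide_distrib)
    then have "(\<Sum>i<n. \<bar>\<alpha> i\<bar> * \<bar>a i\<bar>) \<le> A"
      using A q(3) by (simp add: add.commute pos_divide_le_eq flip: sum_divide_distrib)
    moreover have "\<bar>\<Sum>i<n. \<alpha> i * a i\<bar> \<le> (\<Sum>i<n. \<bar>\<alpha> i\<bar> * \<bar>a i\<bar>)"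
      by (rule order_trans[OF sum_abs]) (simp add: abs_mult)
    ultimately show ?thesis by (simp add: A_def)
  qed
qed

text \<open>For p > 1 and A > 0 the extremal coefficients of Hoelder's inequality are
  \<open>sgn (a i) * (\<bar>a i\<bar> / A) powr (p - 1)\<close>, admissible because
  \<open>(p - 1) * q = p\<close>. For p = 1 the signs suffice.\<close>

lemma lp_norm_attained:
  obtains \<alpha> where "lq_norm (conj_exponent p) n \<alpha> \<le> 1" "(\<Sum>i<n. \<alpha> i * a i) = lp_norm p n a"
proof (cases "p = 1")
  case True
  show ?thesis
  proof (rule that[of "\<lambda>i. sgn (a i)"])
    show "lq_norm (conj_exponent p) n (\<lambda>i. sgn (a i)) \<le> 1"
      by (simp add: True conj_exponent_def lq_norm_infinity_le_iff sgn_if)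
    have "sgn (a i) * a i = \<bar>a i\<bar>" for i by (simp add: sgn_if abs_if)
    then show "(\<Sum>i<n. sgn (a i) * a i) = lp_norm p n a"
      by (simp add: True lp_norm_eq sum_nonneg)
  qed
next
  case False
  then have p1: "1 < p" using p by simp
  define q where "q = p / (p - 1)"
  note q = conj_exponent_gt_1[OF p1, folded q_def]
  define A where "A = lp_norm p n a"
  show ?thesis
  proof (cases "A = 0")
    case True
    show ?thesis
      by (rule that[of "\<lambda>i. 0"]) (use True in \<open>simp_all add: A_def lq_norm_zero\<close>)
  next
    case False
    then have A: "A > 0" using lp_norm_nonneg[of p n a] by (simp add: A_def)
    have S: "(\<Sum>i<n. \<bar>a i\<bar> powr p) = A powr p" using p1 by (simp add: A_def lp_norm_powr)
    define \<alpha> where "\<alpha> i = sgn (a i) * (\<bar>a i\<bar> / A) powr (p - 1)" for i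
    show ?thesis
    proof (rule that[of \<alpha>])
      have "\<bar>\<alpha> i\<bar> powr q = \<bar>a i\<bar> powr p / A powr p" for i
        using A q by (cases "a i = 0") (simp_all add: \<alpha>_def abs_mult powr_powr powr_divide)
      then show "lq_norm (conj_exponent p) n \<alpha> \<le> 1"
        using A q by (simp add: lp_norm_eq S flip: sum_divide_distrib)
      have "\<alpha> i * a i = \<bar>a i\<bar> powr p / A powr (p - 1)" for i
      proof -
        have "\<alpha> i * a i = (sgn (a i) * a i) * \<bar>a i\<bar> powr (p - 1) / A powr (p - 1)"
          using A by (simp add: \<alpha>_def powr_divide)
        also have "sgn (a i) * a i = \<bar>a i\<bar>" by (simp add: sgn_if abs_if)
        also have "\<bar>a i\<bar> * \<bar>a i\<bar> powr (p - 1) = \<bar>a i\<bar> powr p"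
          by (cases "a i = 0") (simp_all add: powr_diff)
        finally show ?thesis .
      qed
      then have "(\<Sum>i<n. \<alpha> i * a i) = A powr p / A powr (p - 1)"
        by (simp add: S flip: sum_divide_distrib)
      also have "\<dots> = A" using A by (simp flip: powr_diff)
      finally show "(\<Sum>i<n. \<alpha> i * a i) = lp_norm p n a" by (simp add: A_def)
    qed
  qed
qed

text \<open>Carries facts about weak norms over to scalar families: Minkowski's inequality and the
  bounds for \<open>s i *\<^sub>R w\<close> and for evaluations follow from it.\<close>

lemma weak_norm_real: "weak_norm p n a = lp_norm p n a"
proof (rule antisym)
  show "weak_norm p n a \<le> lp_norm p n a"
    by (rule weak_norm_least) (use Hoelder_lq_norm in auto)
  obtain \<alpha> where "lq_norm (conj_exponent p) n \<alpha> \<le> 1" "(\<Sum>i<n. \<alpha> i * a i) = lp_norm p n a"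
    by (rule lp_norm_attained)
  then show "lp_norm p n a \<le> weak_norm p n a"
    using weak_norm_upper[of n \<alpha> a] by (simp add: abs_le_iff)
qed

lemma lp_norm_triangle: "lp_norm p n (\<lambda>i. a i + b i) \<le> lp_norm p n a + lp_norm p n b"
  using weak_norm_triangle[of n a b] by (simp add: weak_norm_real)

lemma lp_norm_le_add:
  assumes "\<And>i. i < n \<Longrightarrow> \<bar>c i\<bar> \<le> \<bar>a i\<bar> + \<bar>b i\<bar>"
  shows "lp_norm p n c \<le> lp_norm p n a + lp_norm p n b"
proof -
  have "lp_norm p n c \<le> lp_norm p n (\<lambda>i. \<bar>a i\<bar> + \<bar>b i\<bar>)"
    by (rule lp_norm_mono) (use assms in force)
  also have "\<dots> \<le> lp_norm p n (\<lambda>i. \<bar>a i\<bar>) + lp_norm p n (\<lambda>i. \<bar>b i\<bar>)"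
    by (rule lp_norm_triangle)
  finally show ?thesis by (simp add: lp_norm_eq)
qed

lemma weak_norm_scaleR: "weak_norm p n (\<lambda>i. s i *\<^sub>R w) \<le> lp_norm p n s * norm w"
  using weak_norm_bounded_linear[of "\<lambda>c. c *\<^sub>R w" "norm w" n s]
  by (simp add: weak_norm_real bounded_linear_scaleR_left)

lemma lp_norm_evaluation:
  "lp_norm p n (\<lambda>i. blinfun_apply (v i) x) \<le> weak_norm p n v * norm x"
  unfolding weak_norm_real[symmetric]
  by (rule weak_norm_bounded_linear[OF blinfun.bounded_linear_left norm_blinfun norm_ge_zero])

end

section \<open>The lattices of homogeneous functions\<close>

lemma p_summing_bound:
  assumes "p_summing p S"
  obtains C where "0 \<le> C" "\<And>n x. lp_norm p n (\<lambda>i. norm (S (x i))) \<le> C * weak_norm p n x"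
  using assms unfolding p_summing_def pi_summing_def INF_less_iff by (auto simp: lp_norm_eq)

text \<open>A constant below the infimum is not admissible, and a family refuting it is the witness.
  This covers the value \<infinity> as well.\<close>

lemma pi_summing_greaterE:
  assumes "ennreal c < pi_summing p V S" "0 \<le> c"
  obtains n x where "\<And>i. i < n \<Longrightarrow> x i \<in> V" "c * weak_norm p n x < lp_norm p n (\<lambda>i. norm (S (x i)))"
proof -
  have "\<not> (\<forall>n x. (\<forall>i<n. x i \<in> V) \<longrightarrow> lp_norm p n (\<lambda>i. norm (S (x i))) \<le> c * weak_norm p n x)"
  proof
    assume "\<forall>n x. (\<forall>i<n. x i \<in> V) \<longrightarrow> lp_norm p n (\<lambda>i. norm (S (x i))) \<le> c * weak_norm p n x"
    then have "pi_summing p V S \<le> ennreal c"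
      unfolding pi_summing_def using assms(2) by (intro INF_lower) (simp add: lp_norm_eq)
    then show False using assms(1) by simp
  qed
  then show thesis using that by (metis not_le)
qed

lemma Hnorm_less_iff:
  "Hnorm p f < e \<longleftrightarrow> (\<exists>C\<ge>0. ennreal C < e \<and>
     (\<forall>n x'. lp_norm p n (\<lambda>i. f (x' i)) \<le> C * weak_norm p n x'))"
  unfolding Hnorm_def INF_less_iff by (auto simp: lp_norm_eq)

lemma order_ideal_HwD:
  assumes "order_ideal_Hw L" "g \<in> L" "f \<in> Hw" "\<And>x'. \<bar>f x'\<bar> \<le> \<bar>g x'\<bar>"
  shows "f \<in> L"
  using assms by (simp add: order_ideal_Hw_def)

lemma Hwp_iff:
  "f \<in> Hwp p \<longleftrightarrow> f \<in> Hw \<and>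
     (\<exists>C\<ge>0. \<forall>n x'. lp_norm p n (\<lambda>i. f (x' i)) \<le> C * weak_norm p n x')"
  by (simp add: Hwp_def Hnorm_less_iff)

section \<open>Closure properties of the lattice \<open>Hw\<close>\<close>

lemma HwI:
  assumes "\<And>t x'. 0 \<le> t \<Longrightarrow> f (t *\<^sub>R x') = t * f x'"
    and "\<And>B. bounded B \<Longrightarrow> continuous_map (subtopology strong_operator_topology B) euclideanreal f"
  shows "f \<in> Hw"
  using assms by (auto simp: Hw_def)

lemma Hw_homogeneous: "f \<in> Hw \<Longrightarrow> 0 \<le> t \<Longrightarrow> f (t *\<^sub>R x') = t * f x'"
  by (simp add: Hw_def)

lemma Hw_continuous:
  "f \<in> Hw \<Longrightarrow> bounded B \<Longrightarrow> continuous_map (subtopology strong_operator_topology B) euclideanreal f"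
  by (simp add: Hw_def)

lemma Hw_zero: "(\<lambda>x'. 0) \<in> Hw"
  by (rule HwI) auto

lemma Hw_add: "f \<in> Hw \<Longrightarrow> g \<in> Hw \<Longrightarrow> (\<lambda>x'. f x' + g x') \<in> Hw"
  by (rule HwI, simp add: Hw_homogeneous distrib_left, (rule continuous_map_add; rule Hw_continuous))

lemma Hw_scale: "f \<in> Hw \<Longrightarrow> (\<lambda>x'. c * f x') \<in> Hw"
  by (rule HwI, simp add: Hw_homogeneous, (rule continuous_map_real_mult_left; rule Hw_continuous))

lemma Hw_max: "f \<in> Hw \<Longrightarrow> g \<in> Hw \<Longrightarrow> (\<lambda>x'. max (f x') (g x')) \<in> Hw"
  by (rule HwI, simp add: Hw_homogeneous max_mult_distrib_left,
      (rule continuous_map_real_max; rule Hw_continuous))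

lemma Hw_min: "f \<in> Hw \<Longrightarrow> g \<in> Hw \<Longrightarrow> (\<lambda>x'. min (f x') (g x')) \<in> Hw"
  by (rule HwI, simp add: Hw_homogeneous min_mult_distrib_left,
      (rule continuous_map_real_min; rule Hw_continuous))

lemma Hw_abs: "f \<in> Hw \<Longrightarrow> (\<lambda>x'. \<bar>f x'\<bar>) \<in> Hw"
  by (rule HwI, simp add: Hw_homogeneous abs_mult, (rule continuous_map_real_abs; rule Hw_continuous))

text \<open>The product has degree 2 and the square root restores degree 1; \<open>sqrt\<close> is
  multiplicative and continuous on the whole real line, negative arguments included.\<close>

lemma Hw_geometric_mean: "f \<in> Hw \<Longrightarrow> g \<in> Hw \<Longrightarrow> (\<lambda>x'. sqrt (f x' * g x')) \<in> Hw"
  by (rule HwI, simp add: Hw_homogeneous real_sqrt_mult mult_ac,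
      (rule continuous_map_sqrt, rule continuous_map_real_mult; rule Hw_continuous))

lemma evaluation_in_Hw: "evaluation x \<in> Hw"
  by (rule HwI)
    (auto simp: evaluation_def blinfun.scaleR_left
      intro!: continuous_map_from_subtopology strong_operator_topology_continuous_evaluation)

section \<open>Weak-star continuity for adjoints of compact operators\<close>

lemma dual_operator_apply: "blinfun_apply (dual_operator T x') z = x' (T z)"
  by (simp add: dual_operator.rep_eq)

text \<open>For a unit vector u, \<open>T u\<close> lies within d of some point of the net k, and
  there \<open>x'\<close> is at most e in absolute value.\<close>

lemma norm_dual_operator_le:
  assumes net: "blinfun_apply T ` cball 0 1 \<subseteq> (\<Union>y\<in>k. ball y d)"
    and k: "\<And>y. y \<in> k \<Longrightarrow> \<bar>blinfun_apply x' y\<bar> \<le> e" and "0 \<le> e" "0 \<le> d"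
  shows "norm (dual_operator T x') \<le> e + norm x' * d"
proof (rule norm_blinfun_bound)
  show "0 \<le> e + norm x' * d" using assms by simp
  fix z
  show "norm (dual_operator T x' z) \<le> (e + norm x' * d) * norm z"
  proof (cases "z = 0")
    case False
    define u where "u = z /\<^sub>R norm z"
    have u: "norm u = 1" "z = norm z *\<^sub>R u" using False by (simp_all add: u_def)
    then have "T u \<in> (\<Union>y\<in>k. ball y d)" using net by force
    then obtain y where y: "y \<in> k" "norm (T u - y) < d"
      by (auto simp: dist_norm norm_minus_commute)
    have "\<bar>x' (T u)\<bar> \<le> \<bar>x' y\<bar> + \<bar>x' (T u - y)\<bar>" by (simp add: blinfun.diff_right)
    also have "\<bar>x' (T u - y)\<bar> \<le> norm x' * d"
      using norm_blinfun[of x' "T u - y"] y(2) mult_left_mono[of "norm (T u - y)" d "norm x'"]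
      by simp
    finally have "\<bar>x' (T u)\<bar> \<le> e + norm x' * d" using k[OF y(1)] by simp
    moreover have "dual_operator T x' z = norm z * x' (T u)"
      using u(2) by (metis blinfun.scaleR_right dual_operator_apply real_scaleR_def)
    ultimately show ?thesis
      by (simp add: abs_mult mult.commute mult_left_mono)
  qed simp
qed

text \<open>The image of the ball has a finite net, so closeness at finitely many points, which is a
  weak-star condition, controls the norm of the adjoint on a bounded set.\<close>

lemma norm_dual_operator_in_Hw:
  fixes T :: "'z::real_normed_vector \<Rightarrow>\<^sub>L 'x::real_normed_vector"
  assumes "compact_operator T"
  shows "(\<lambda>x'. norm (dual_operator T x')) \<in> Hw"
proof (rule HwI)
  show "norm (dual_operator T (t *\<^sub>R x')) = t * norm (dual_operator T x')" if "0 \<le> t" for t x'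
    using that by (simp add: blinfun.scaleR_right)
  fix B :: "('x \<Rightarrow>\<^sub>L real) set" assume "bounded B"
  then obtain R where R: "R > 0" "\<And>x'. x' \<in> B \<Longrightarrow> norm x' \<le> R"
    by (auto simp: bounded_pos)
  let ?X = "subtopology strong_operator_topology B"
  show "continuous_map ?X euclideanreal (\<lambda>x'. norm (dual_operator T x'))"
    unfolding continuous_map_atin limitin_canonical_iff
  proof (intro ballI tendstoI)
    fix a and e :: real assume "a \<in> topspace ?X" and e: "0 < e"
    then have a: "a \<in> B" by simp
    \<comment> \<open>Two members of B are at most 2 R apart, so the net radius costs e/4; the net
      points cost another e/4.\<close>
    define d where "d = e / (8 * R)"
    have d: "d > 0" "2 * R * d = e / 4" using e R by (simp_all add: d_def)
    obtain k where k: "finite k" "closure (blinfun_apply T ` cball 0 1) \<subseteq> (\<Union>y\<in>k. ball y d)"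
      using assms d(1) unfolding compact_operator_def compact_eq_totally_bounded by blast
    have net: "blinfun_apply T ` cball 0 1 \<subseteq> (\<Union>y\<in>k. ball y d)"
      by (rule order_trans[OF closure_subset k(2)])
    define U where "U = {x'. \<forall>y\<in>k. blinfun_apply x' y \<in> ball (a y) (e / 4)}"
    have "openin strong_operator_topology U"
      unfolding U_def by (rule strong_operator_topology_basis[OF k(1)]) simp
    then have "openin ?X (U \<inter> B)" by (auto simp: openin_subtopology)
    moreover have "a \<in> U \<inter> B" using a e by (simp add: U_def)
    moreover have "dist (norm (dual_operator T x')) (norm (dual_operator T a)) < e"
      if "x' \<in> U \<inter> B" for x'
    proof -
      have "dist (norm (dual_operator T x')) (norm (dual_operator T a)) \<le> norm (dual_operator T (x' - a))"
        by (simp add: dist_real_def blinfun.diff_right norm_triangle_ineq3)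
      also have "\<dots> \<le> e / 4 + norm (x' - a) * d"
        by (rule norm_dual_operator_le[OF net])
          (use that d e in \<open>auto simp: U_def dist_real_def blinfun.diff_left abs_minus_commute less_imp_le\<close>)
      also have "norm (x' - a) * d \<le> 2 * R * d"
        using R(2)[OF a] R(2)[of x'] that d norm_triangle_ineq4[of x' a]
        by (intro mult_right_mono) auto
      finally show ?thesis using d e by simp
    qed
    ultimately show "\<forall>\<^sub>F x' in atin ?X a. dist (norm (dual_operator T x')) (norm (dual_operator T a)) < e"
      unfolding eventually_atin by blast
  qed
qed

section \<open>Norm closures and ideals inside \<open>Hwp\<close>\<close>

context
  fixes p :: real
  assumes p: "1 \<le> p"
begin

lemma Hwp_closureD:
  assumes "f \<in> Hwp_closure p A" "0 < e"
  obtains g where "g \<in> A" "\<And>n x'. lp_norm p n (\<lambda>i. f (x' i) - g (x' i)) \<le> e * weak_norm p n x'"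
proof -
  obtain g where g: "g \<in> A" "Hnorm p (\<lambda>x'. f x' - g x') < ennreal e"
    using assms by (auto simp: Hwp_closure_def)
  then obtain C where C: "0 \<le> C" "ennreal C < ennreal e"
    "\<And>n x'. lp_norm p n (\<lambda>i. f (x' i) - g (x' i)) \<le> C * weak_norm p n x'"
    unfolding Hnorm_less_iff by auto
  then have "C \<le> e" by (simp add: ennreal_less_iff)
  then show ?thesis
    by (intro that[OF g(1)] order_trans[OF C(3)] mult_right_mono weak_norm_nonneg p)
qed

lemma Hwp_closureI:
  assumes "f \<in> Hwp p"
    and "\<And>e. 0 < e \<Longrightarrow> \<exists>g\<in>A \<inter> Hwp p.
      \<forall>n x'. lp_norm p n (\<lambda>i. f (x' i) - g (x' i)) \<le> e * weak_norm p n x'"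
  shows "f \<in> Hwp_closure p A"
  unfolding Hwp_closure_def mem_Collect_eq
proof (intro conjI allI impI assms(1))
  fix e :: real assume e: "0 < e"
  \<comment> \<open>Halving e turns the non-strict bound of the hypothesis into the strict one that
    the closure demands.\<close>
  then obtain g where g: "g \<in> A \<inter> Hwp p"
    "\<forall>n x'. lp_norm p n (\<lambda>i. f (x' i) - g (x' i)) \<le> e / 2 * weak_norm p n x'"
    using assms(2)[of "e / 2"] by auto
  then have "Hnorm p (\<lambda>x'. f x' - g x') < ennreal e"
    unfolding Hnorm_less_iff using e by (intro exI[of _ "e / 2"]) (auto simp: ennreal_less_iff)
  then show "\<exists>g\<in>A \<inter> Hwp p. Hnorm p (\<lambda>x'. f x' - g x') < ennreal e" using g(1) by blast
qed

lemma Hwp_closure_superset: "A \<subseteq> Hwp p \<Longrightarrow> A \<subseteq> Hwp_closure p A"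
  by (rule subsetI, rule Hwp_closureI)
    (auto simp: lq_norm_zero intro!: bexI mult_nonneg_nonneg weak_norm_nonneg p)

text \<open>Two dominating functions cover at once sums, dominated functions (with h = 0) and the
  geometric mean.\<close>

lemma HwpI_dominated:
  assumes "f \<in> Hw" "g \<in> Hwp p" "h \<in> Hwp p" "\<And>x'. \<bar>f x'\<bar> \<le> \<bar>g x'\<bar> + \<bar>h x'\<bar>"
  shows "f \<in> Hwp p"
proof -
  obtain C D where C: "0 \<le> C" "\<And>n x'. lp_norm p n (\<lambda>i. g (x' i)) \<le> C * weak_norm p n x'"
    and D: "0 \<le> D" "\<And>n x'. lp_norm p n (\<lambda>i. h (x' i)) \<le> D * weak_norm p n x'"
    using assms(2,3) unfolding Hwp_iff by blast
  have "lp_norm p n (\<lambda>i. f (x' i)) \<le> (C + D) * weak_norm p n x'" for n x'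
    using lp_norm_le_add[OF p, of n "\<lambda>i. f (x' i)" "\<lambda>i. g (x' i)" "\<lambda>i. h (x' i)"] assms(4)
      C(2)[of n x'] D(2)[of n x'] by (simp add: algebra_simps)
  then show ?thesis
    unfolding Hwp_iff using assms(1) C(1) D(1) by (intro conjI exI[of _ "C + D"]) auto
qed

lemma Hwp_zero: "(\<lambda>x'. 0) \<in> Hwp p"
  unfolding Hwp_iff by (auto simp: Hw_zero lq_norm_zero intro!: exI[of _ 0])

lemma Hwp_scale:
  assumes "f \<in> Hwp p"
  shows "(\<lambda>x'. c * f x') \<in> Hwp p"
proof -
  obtain C where C: "0 \<le> C" "\<And>n x'. lp_norm p n (\<lambda>i. f (x' i)) \<le> C * weak_norm p n x'"
    using assms unfolding Hwp_iff by blast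
  have "lp_norm p n (\<lambda>i. c * f (x' i)) \<le> (\<bar>c\<bar> * C) * weak_norm p n x'" for n x'
    using C(2)[of n x'] by (simp add: lp_norm_scale[OF p] mult.assoc mult_left_mono)
  then show ?thesis
    unfolding Hwp_iff using assms C(1)
    by (intro conjI exI[of _ "\<bar>c\<bar> * C"]) (auto simp: Hwp_def Hw_scale)
qed

lemma order_ideal_Hwp: "order_ideal_Hw (Hwp p)"
  unfolding order_ideal_Hw_def linear_subspace_Hw_def
proof (intro conjI ballI allI impI)
  show "Hwp p \<subseteq> Hw" by (auto simp: Hwp_def)
  show "(\<lambda>x'. f x' + g x') \<in> Hwp p" if "f \<in> Hwp p" "g \<in> Hwp p" for f g
    by (rule HwpI_dominated[OF _ that]) (use that in \<open>auto simp: Hwp_def Hw_add\<close>)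
  show "f \<in> Hwp p" if "g \<in> Hwp p" "f \<in> Hw" "\<forall>x'. \<bar>f x'\<bar> \<le> \<bar>g x'\<bar>" for f g
    by (rule HwpI_dominated[OF _ that(1) Hwp_zero]) (use that in auto)
qed (auto simp: Hwp_zero Hwp_scale)

lemma evaluation_in_Hwp: "evaluation x \<in> Hwp p"
  unfolding Hwp_iff
proof (intro conjI evaluation_in_Hw exI[of _ "norm x"] allI norm_ge_zero)
  show "lp_norm p n (\<lambda>i. evaluation x (x' i)) \<le> norm x * weak_norm p n x'" for n x'
    using lp_norm_evaluation[OF p, of n x' x] by (simp add: evaluation_def mult.commute)
qed

text \<open>\<open>Hwp p\<close> is itself an order ideal containing \<open>FBL p\<close>, so the
  hull stays inside it.\<close>

lemma Iw_subset_Hwp: "Iw p \<subseteq> Hwp p"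
  unfolding Iw_def by (rule hull_minimal) (auto simp: FBL_def Hwp_closure_def order_ideal_Hwp)

lemma evaluation_in_FBL: "evaluation x \<in> FBL p"
  unfolding FBL_def
proof (rule Hwp_closureI[OF evaluation_in_Hwp])
  fix e :: real assume "0 < e"
  moreover have "evaluation x \<in> FVL" unfolding FVL_def by (simp add: hull_inc)
  ultimately show "\<exists>g\<in>FVL \<inter> Hwp p. \<forall>n x'.
    lp_norm p n (\<lambda>i. evaluation x (x' i) - g (x' i)) \<le> e * weak_norm p n x'"
    by (intro bexI[of _ "evaluation x"]) (auto simp: lq_norm_zero weak_norm_nonneg p evaluation_in_Hwp)
qed

text \<open>Supplies the members of the ideal that approximate the geometric mean.\<close>

lemma dominated_by_evaluation_in_Iw:
  fixes x :: "'x::real_normed_vector"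
  assumes "f \<in> Hw" "\<And>x'. \<bar>f x'\<bar> \<le> \<bar>c * evaluation x x'\<bar>"
  shows "f \<in> Iw p"
  unfolding Iw_def hull_def
proof (intro InterI, clarify)
  fix L :: "'x dual_fun set" assume L: "order_ideal_Hw L" "FBL p \<subseteq> L"
  have "(\<lambda>x'. c * evaluation x x') \<in> L"
    using L evaluation_in_FBL unfolding order_ideal_Hw_def linear_subspace_Hw_def by blast
  then show "f \<in> L" using order_ideal_HwD[OF L(1) _ assms] by blast
qed

end

section \<open>Functions in the ideal, close to annihilators\<close>

text \<open>An eventuality quantifier along the finite subsets of \<open>X0\<close>: a larger \<open>F\<close> makes the condition
  weaker.\<close>

definition on_annihilators ::
  "'x::real_normed_vector set \<Rightarrow> (nat \<Rightarrow> (nat \<Rightarrow> 'x \<Rightarrow>\<^sub>L real) \<Rightarrow> (nat \<Rightarrow> real) \<Rightarrow> bool) \<Rightarrow> bool" where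
  "on_annihilators X0 P \<longleftrightarrow> (\<exists>F. finite F \<and> F \<subseteq> X0 \<and>
     (\<forall>n v s. (\<forall>i<n. v i \<in> (\<Inter>x\<in>F. annihilator x) \<and> 0 \<le> s i) \<longrightarrow> P n v s))"

text \<open>The error also involves \<open>lp_norm p n s\<close>, since replacing \<open>h\<close>
  by an approximant changes its values at \<open>s i *\<^sub>R w\<close>. This makes the property
  stable under limits in the p-norm.\<close>

definition almost_split ::
  "real \<Rightarrow> 'x::real_normed_vector set \<Rightarrow> ('x \<Rightarrow>\<^sub>L real) \<Rightarrow> 'x dual_fun \<Rightarrow> bool" where
  "almost_split p X0 w h \<longleftrightarrow> (\<forall>e>0. on_annihilators X0 (\<lambda>n v s.
     lp_norm p n (\<lambda>i. h (s i *\<^sub>R w + v i) - h (s i *\<^sub>R w)) \<le> e * (weak_norm p n v + lp_norm p n s)))"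

text \<open>The order of the quantifiers over \<open>M\<close> and \<open>e\<close> is essential. It is lost in limits, which is
  why \<open>almost_split\<close> is needed to reach the closure \<^const>\<open>FBL\<close>.\<close>

definition tame ::
  "real \<Rightarrow> 'x::real_normed_vector set \<Rightarrow> ('x \<Rightarrow>\<^sub>L real) \<Rightarrow> 'x dual_fun \<Rightarrow> bool" where
  "tame p X0 w f \<longleftrightarrow> (\<exists>M\<ge>0. \<forall>e>0. on_annihilators X0 (\<lambda>n v s.
     lp_norm p n (\<lambda>i. f (s i *\<^sub>R w + v i)) \<le> e * weak_norm p n v + M * lp_norm p n s))"

text \<open>The union of the two finite sets works for both conditions, as its annihilator lies in
  each of theirs.\<close>

lemma on_annihilators_mono2:
  assumes "on_annihilators X0 P" "on_annihilators X0 Q"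
    and "\<And>n v s. (\<And>i. i < n \<Longrightarrow> 0 \<le> s i) \<Longrightarrow> P n v s \<Longrightarrow> Q n v s \<Longrightarrow> R n v s"
  shows "on_annihilators X0 R"
proof -
  obtain F where F: "finite F" "F \<subseteq> X0"
    "\<forall>n v s. (\<forall>i<n. v i \<in> (\<Inter>x\<in>F. annihilator x) \<and> 0 \<le> s i) \<longrightarrow> P n v s"
    using assms(1) unfolding on_annihilators_def by blast
  obtain G where G: "finite G" "G \<subseteq> X0"
    "\<forall>n v s. (\<forall>i<n. v i \<in> (\<Inter>x\<in>G. annihilator x) \<and> 0 \<le> s i) \<longrightarrow> Q n v s"
    using assms(2) unfolding on_annihilators_def by blast
  show ?thesis
    unfolding on_annihilators_def
  proof (intro exI[of _ "F \<union> G"] conjI allI impI)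
    fix n and v :: "nat \<Rightarrow> 'a \<Rightarrow>\<^sub>L real" and s :: "nat \<Rightarrow> real"
    assume "\<forall>i<n. v i \<in> (\<Inter>x\<in>F \<union> G. annihilator x) \<and> 0 \<le> s i"
    then show "R n v s" using F(3) G(3) by (intro assms(3)) auto
  qed (use F G in auto)
qed

lemma on_annihilators_mono:
  assumes "on_annihilators X0 P"
    and "\<And>n v s. (\<And>i. i < n \<Longrightarrow> 0 \<le> s i) \<Longrightarrow> P n v s \<Longrightarrow> R n v s"
  shows "on_annihilators X0 R"
  using on_annihilators_mono2[OF assms(1,1)] assms(2) by blast

lemma on_annihilators_True: "(\<And>n v s. P n v s) \<Longrightarrow> on_annihilators X0 P"
  unfolding on_annihilators_def by (intro exI[of _ "{}"]) simp

lemma on_annihilators_member: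
  assumes "x \<in> X0" "\<And>n v s. (\<And>i. i < n \<Longrightarrow> blinfun_apply (v i) x = 0) \<Longrightarrow> P n v s"
  shows "on_annihilators X0 P"
  unfolding on_annihilators_def
  using assms by (intro exI[of _ "{x}"]) (simp add: annihilator_def)

section \<open>Stability of \<open>almost_split\<close> and \<open>tame\<close>\<close>

context
  fixes p :: real
  assumes p: "1 \<le> p"
begin

lemma lp_norm_le_scaled_add:
  assumes "0 \<le> K" "\<And>i. i < n \<Longrightarrow> \<bar>c i\<bar> \<le> K * (\<bar>a i\<bar> + \<bar>b i\<bar>)"
  shows "lp_norm p n c \<le> K * (lp_norm p n a + lp_norm p n b)"
proof -
  have "lp_norm p n c \<le> lp_norm p n (\<lambda>i. K * a i) + lp_norm p n (\<lambda>i. K * b i)"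
    by (rule lp_norm_le_add[OF p]) (use assms in \<open>auto simp: abs_mult algebra_simps\<close>)
  then show ?thesis using assms(1) by (simp add: lp_norm_scale[OF p] algebra_simps)
qed

text \<open>One Lipschitz estimate treats sums, scalar multiples, maxima and minima alike.\<close>

lemma almost_split_combine:
  assumes f: "almost_split p X0 w f" and g: "almost_split p X0 w g" and K: "0 \<le> K"
    and h: "\<And>x y. \<bar>h x - h y\<bar> \<le> K * (\<bar>f x - f y\<bar> + \<bar>g x - g y\<bar>)"
  shows "almost_split p X0 w h"
  unfolding almost_split_def
proof (intro allI impI)
  fix e :: real assume e: "0 < e"
  \<comment> \<open>Two errors d, amplified by K, must stay below e; the summand 1 keeps the
    denominator positive when K = 0.\<close>
  define d where "d = e / (2 * K + 1)"
  have d: "0 < d" "K * (2 * d) \<le> e" using e K by (simp_all add: d_def field_simps)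
  show "on_annihilators X0 (\<lambda>n v s.
    lp_norm p n (\<lambda>i. h (s i *\<^sub>R w + v i) - h (s i *\<^sub>R w)) \<le> e * (weak_norm p n v + lp_norm p n s))"
  proof (rule on_annihilators_mono2[OF f[unfolded almost_split_def, rule_format, OF d(1)]
        g[unfolded almost_split_def, rule_format, OF d(1)]])
    fix n and v :: "nat \<Rightarrow> 'a \<Rightarrow>\<^sub>L real" and s :: "nat \<Rightarrow> real"
    let ?W = "weak_norm p n v + lp_norm p n s" and ?D = "\<lambda>f i. f (s i *\<^sub>R w + v i) - f (s i *\<^sub>R w)"
    assume fg: "lp_norm p n (?D f) \<le> d * ?W" "lp_norm p n (?D g) \<le> d * ?W"
    have W: "0 \<le> ?W" by (simp add: weak_norm_nonneg[OF p] lp_norm_nonneg)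
    have "lp_norm p n (?D h) \<le> K * (lp_norm p n (?D f) + lp_norm p n (?D g))"
      by (rule lp_norm_le_scaled_add[OF K h])
    also have "\<dots> \<le> K * (d * ?W + d * ?W)"
      by (intro mult_left_mono add_mono fg K)
    also have "\<dots> = K * (2 * d) * ?W" by (simp add: algebra_simps)
    also have "\<dots> \<le> e * ?W" by (rule mult_right_mono[OF d(2) W])
    finally show "lp_norm p n (?D h) \<le> e * ?W" .
  qed
qed

lemma almost_split_zero: "almost_split p X0 w (\<lambda>x'. 0)"
  unfolding almost_split_def
  by (auto simp: lq_norm_zero weak_norm_nonneg[OF p] lp_norm_nonneg intro!: on_annihilators_True)

text \<open>By density x has a neighbour y in \<open>X0\<close>. If all \<open>v i\<close>
  annihilate y, they see x only through x - y, and the contribution of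
  \<open>s i *\<^sub>R w\<close> cancels by linearity.\<close>

lemma almost_split_evaluation:
  assumes "closure X0 = UNIV"
  shows "almost_split p X0 w (evaluation x)"
  unfolding almost_split_def
proof (intro allI impI)
  fix e :: real assume e: "0 < e"
  then obtain y where y: "y \<in> X0" "norm (x - y) < e"
    using assms closure_approachable[of x X0] by (auto simp: dist_norm norm_minus_commute)
  show "on_annihilators X0 (\<lambda>n v s.
    lp_norm p n (\<lambda>i. evaluation x (s i *\<^sub>R w + v i) - evaluation x (s i *\<^sub>R w)) \<le>
      e * (weak_norm p n v + lp_norm p n s))"
  proof (rule on_annihilators_member[OF y(1)])
    fix n and v :: "nat \<Rightarrow> 'a \<Rightarrow>\<^sub>L real" and s :: "nat \<Rightarrow> real"
    assume v: "\<And>i. i < n \<Longrightarrow> blinfun_apply (v i) y = 0"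
    have "lp_norm p n (\<lambda>i. evaluation x (s i *\<^sub>R w + v i) - evaluation x (s i *\<^sub>R w)) \<le>
        lp_norm p n (\<lambda>i. v i (x - y))"
      by (rule lp_norm_mono[OF p])
        (simp add: v evaluation_def blinfun.add_left blinfun.diff_right)
    also have "\<dots> \<le> weak_norm p n v * norm (x - y)" by (rule lp_norm_evaluation[OF p])
    also have "\<dots> \<le> weak_norm p n v * e"
      using y by (intro mult_left_mono weak_norm_nonneg p) simp
    also have "\<dots> \<le> e * (weak_norm p n v + lp_norm p n s)"
      using e lp_norm_nonneg[of p n s] by (simp add: algebra_simps)
    finally show "lp_norm p n (\<lambda>i. evaluation x (s i *\<^sub>R w + v i) - evaluation x (s i *\<^sub>R w)) \<le>
      e * (weak_norm p n v + lp_norm p n s)" .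
  qed
qed

text \<open>The almost split members of \<open>Hw\<close> form a vector sublattice containing the
  evaluations.\<close>

lemma almost_split_FVL:
  assumes "closure X0 = UNIV"
  shows "FVL \<subseteq> {h \<in> Hw. almost_split p X0 w h}"
  unfolding FVL_def
proof (rule hull_minimal)
  show "range evaluation \<subseteq> {h \<in> Hw. almost_split p X0 w h}"
    by (auto simp: evaluation_in_Hw almost_split_evaluation[OF assms])
  have "almost_split p X0 w (\<lambda>x'. f x' + g x')"
    "almost_split p X0 w (\<lambda>x'. max (f x') (g x'))" "almost_split p X0 w (\<lambda>x'. min (f x') (g x'))"
    if "almost_split p X0 w f" "almost_split p X0 w g" for f g
    by (rule almost_split_combine[OF that, of 1]; auto)+
  moreover have "almost_split p X0 w (\<lambda>x'. c * f x')" if "almost_split p X0 w f" for c f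
    by (rule almost_split_combine[OF that that, of "\<bar>c\<bar>"])
      (auto simp: abs_mult mult_left_mono simp flip: right_diff_distrib)
  ultimately show "vector_sublattice_Hw {h \<in> Hw. almost_split p X0 w h}"
    unfolding vector_sublattice_Hw_def linear_subspace_Hw_def
    by (auto simp: almost_split_zero Hw_zero Hw_add Hw_scale Hw_max Hw_min)
qed

text \<open>Triangle inequality through an approximant g in \<open>FVL\<close>: h and g are compared
  on the families \<open>s i *\<^sub>R w + v i\<close> and \<open>s i *\<^sub>R w\<close>, whose
  weak norms are controlled by those of v and s.\<close>

lemma almost_split_FBL:
  assumes "closure X0 = UNIV" "h \<in> FBL p"
  shows "almost_split p X0 w h"
  unfolding almost_split_def
proof (intro allI impI)
  fix e :: real assume e: "0 < e"
  \<comment> \<open>The three errors sum to d times 2 V + (1 + 2 \<open>norm w\<close>) S, where V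
    and S are the norms of v and s.\<close>
  define d where "d = e / (2 + 2 * norm w)"
  have "2 + 2 * norm w > 0" using norm_ge_zero[of w] by linarith
  then have d: "0 < d" "d * (2 + 2 * norm w) = e" using e by (simp_all add: d_def)
  obtain g where g: "g \<in> FVL"
    "\<And>n x'. lp_norm p n (\<lambda>i. h (x' i) - g (x' i)) \<le> d * weak_norm p n x'"
    using Hwp_closureD[OF p _ d(1)] assms(2) unfolding FBL_def by blast
  have split_g: "almost_split p X0 w g" using almost_split_FVL[OF assms(1)] g(1) by blast
  show "on_annihilators X0 (\<lambda>n v s.
    lp_norm p n (\<lambda>i. h (s i *\<^sub>R w + v i) - h (s i *\<^sub>R w)) \<le> e * (weak_norm p n v + lp_norm p n s))"
  proof (rule on_annihilators_mono[OF split_g[unfolded almost_split_def, rule_format, OF d(1)]])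
    fix n and v :: "nat \<Rightarrow> 'a \<Rightarrow>\<^sub>L real" and s :: "nat \<Rightarrow> real"
    let ?V = "weak_norm p n v" and ?S = "lp_norm p n s"
    let ?D = "\<lambda>f i. f (s i *\<^sub>R w + v i) - f (s i *\<^sub>R w)"
    have V: "0 \<le> ?V" "0 \<le> ?S" by (simp_all add: weak_norm_nonneg[OF p] lp_norm_nonneg)
    assume "lp_norm p n (?D g) \<le> d * (?V + ?S)"
    moreover have "lp_norm p n (?D h) \<le> lp_norm p n (?D g) + lp_norm p n (?D (\<lambda>x'. h x' - g x'))"
      by (rule lp_norm_le_add[OF p]) auto
    moreover have "lp_norm p n (?D (\<lambda>x'. h x' - g x')) \<le>
        lp_norm p n (\<lambda>i. h (s i *\<^sub>R w + v i) - g (s i *\<^sub>R w + v i)) +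
        lp_norm p n (\<lambda>i. h (s i *\<^sub>R w) - g (s i *\<^sub>R w))"
      by (rule lp_norm_le_add[OF p]) auto
    moreover have "lp_norm p n (\<lambda>i. h (s i *\<^sub>R w + v i) - g (s i *\<^sub>R w + v i)) \<le> d * (?S * norm w + ?V)"
      using weak_norm_triangle[OF p, of n "\<lambda>i. s i *\<^sub>R w" v] weak_norm_scaleR[OF p, of n s w] d(1)
      by (intro order_trans[OF g(2)] mult_left_mono) auto
    moreover have "lp_norm p n (\<lambda>i. h (s i *\<^sub>R w) - g (s i *\<^sub>R w)) \<le> d * (?S * norm w)"
      using weak_norm_scaleR[OF p, of n s w] d(1) by (intro order_trans[OF g(2)] mult_left_mono) auto
    ultimately have "lp_norm p n (?D h) \<le> d * (2 * ?V + (1 + 2 * norm w) * ?S)"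
      by (simp add: algebra_simps)
    also have "\<dots> \<le> d * ((2 + 2 * norm w) * (?V + ?S))"
    proof (rule mult_left_mono)
      have "0 \<le> norm w * ?V" using V by simp
      then show "2 * ?V + (1 + 2 * norm w) * ?S \<le> (2 + 2 * norm w) * (?V + ?S)"
        using V by (simp add: algebra_simps)
    qed (use d in simp)
    also have "\<dots> = e * (?V + ?S)" by (simp only: d(2) flip: mult.assoc)
    finally show "lp_norm p n (?D h) \<le> e * (?V + ?S)" .
  qed
qed

text \<open>Pointwise domination replaces the Lipschitz condition, which brings order ideals within
  reach. The new constant \<open>K * (M + N)\<close> is fixed before e.\<close>

lemma tame_combine:
  assumes f: "tame p X0 w f" and g: "tame p X0 w g" and K: "0 \<le> K"
    and h: "\<And>x. \<bar>h x\<bar> \<le> K * (\<bar>f x\<bar> + \<bar>g x\<bar>)"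
  shows "tame p X0 w h"
proof -
  obtain M where M: "0 \<le> M" "\<And>e. 0 < e \<Longrightarrow> on_annihilators X0 (\<lambda>n v s.
      lp_norm p n (\<lambda>i. f (s i *\<^sub>R w + v i)) \<le> e * weak_norm p n v + M * lp_norm p n s)"
    using f unfolding tame_def by blast
  obtain N where N: "0 \<le> N" "\<And>e. 0 < e \<Longrightarrow> on_annihilators X0 (\<lambda>n v s.
      lp_norm p n (\<lambda>i. g (s i *\<^sub>R w + v i)) \<le> e * weak_norm p n v + N * lp_norm p n s)"
    using g unfolding tame_def by blast
  show ?thesis
    unfolding tame_def
  proof (intro exI[of _ "K * (M + N)"] conjI allI impI)
    show "0 \<le> K * (M + N)" using K M(1) N(1) by simp
    fix e :: real assume e: "0 < e"
    define d where "d = e / (2 * K + 1)"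
    have d: "0 < d" "K * (2 * d) \<le> e" using e K by (simp_all add: d_def field_simps)
    show "on_annihilators X0 (\<lambda>n v s. lp_norm p n (\<lambda>i. h (s i *\<^sub>R w + v i)) \<le>
      e * weak_norm p n v + K * (M + N) * lp_norm p n s)"
    proof (rule on_annihilators_mono2[OF M(2)[OF d(1)] N(2)[OF d(1)]])
      fix n and v :: "nat \<Rightarrow> 'a \<Rightarrow>\<^sub>L real" and s :: "nat \<Rightarrow> real"
      let ?V = "weak_norm p n v" and ?S = "lp_norm p n s"
      assume fg: "lp_norm p n (\<lambda>i. f (s i *\<^sub>R w + v i)) \<le> d * ?V + M * ?S"
        "lp_norm p n (\<lambda>i. g (s i *\<^sub>R w + v i)) \<le> d * ?V + N * ?S"
      have "lp_norm p n (\<lambda>i. h (s i *\<^sub>R w + v i)) \<le>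
        K * (lp_norm p n (\<lambda>i. f (s i *\<^sub>R w + v i)) + lp_norm p n (\<lambda>i. g (s i *\<^sub>R w + v i)))"
        by (rule lp_norm_le_scaled_add[OF K h])
      also have "\<dots> \<le> K * ((d * ?V + M * ?S) + (d * ?V + N * ?S))"
        by (intro mult_left_mono add_mono fg K)
      also have "\<dots> = K * (2 * d) * ?V + K * (M + N) * ?S"
        by (simp add: algebra_simps)
      also have "\<dots> \<le> e * ?V + K * (M + N) * ?S"
        by (intro add_right_mono mult_right_mono d(2) weak_norm_nonneg p)
      finally show "lp_norm p n (\<lambda>i. h (s i *\<^sub>R w + v i)) \<le> e * ?V + K * (M + N) * ?S" .
    qed
  qed
qed

text \<open>By homogeneity \<open>h (s i *\<^sub>R w) = s i * h w\<close>, so this part costs only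
  \<open>\<bar>h w\<bar>\<close> times the norm of s. Homogeneity holds for nonnegative scalars,
  whence the sign condition on s in \<open>on_annihilators\<close>.\<close>

lemma almost_split_imp_tame:
  assumes "h \<in> Hw" "almost_split p X0 w h"
  shows "tame p X0 w h"
  unfolding tame_def
proof (intro exI[of _ "\<bar>h w\<bar> + 1"] conjI allI impI)
  fix e :: real assume "0 < e"
  \<comment> \<open>Capping the error factor at 1 lets \<open>\<bar>h w\<bar> + 1\<close> serve for
    all e at once.\<close>
  then have e: "0 < min e 1" by simp
  show "on_annihilators X0 (\<lambda>n v s. lp_norm p n (\<lambda>i. h (s i *\<^sub>R w + v i)) \<le>
    e * weak_norm p n v + (\<bar>h w\<bar> + 1) * lp_norm p n s)"
  proof (rule on_annihilators_mono[OF assms(2)[unfolded almost_split_def, rule_format, OF e]])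
    fix n and v :: "nat \<Rightarrow> 'a \<Rightarrow>\<^sub>L real" and s :: "nat \<Rightarrow> real"
    let ?V = "weak_norm p n v" and ?S = "lp_norm p n s"
    assume s: "\<And>i. i < n \<Longrightarrow> 0 \<le> s i"
      and "lp_norm p n (\<lambda>i. h (s i *\<^sub>R w + v i) - h (s i *\<^sub>R w)) \<le> min e 1 * (?V + ?S)"
    moreover have "lp_norm p n (\<lambda>i. h (s i *\<^sub>R w + v i)) \<le>
      lp_norm p n (\<lambda>i. h (s i *\<^sub>R w + v i) - h (s i *\<^sub>R w)) + lp_norm p n (\<lambda>i. h w * s i)"
      by (rule lp_norm_le_add[OF p]) (use s Hw_homogeneous[OF assms(1)] in \<open>auto simp: mult.commute\<close>)
    moreover have "min e 1 * ?V \<le> e * ?V"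
      by (intro mult_right_mono weak_norm_nonneg p) simp
    moreover have "min e 1 * ?S \<le> 1 * ?S"
      by (intro mult_right_mono lp_norm_nonneg) simp
    ultimately show "lp_norm p n (\<lambda>i. h (s i *\<^sub>R w + v i)) \<le> e * ?V + (\<bar>h w\<bar> + 1) * ?S"
      by (simp add: lp_norm_scale[OF p] distrib_left distrib_right)
  qed
qed simp

text \<open>The tame members of \<open>Hw\<close> form an order ideal containing
  \<open>FBL p\<close>.\<close>

lemma tame_Iw:
  assumes "closure X0 = UNIV" "f \<in> Iw p"
  shows "tame p X0 w f"
proof -
  let ?P = "{f \<in> Hw. tame p X0 w f}"
  have "order_ideal_Hw ?P"
    unfolding order_ideal_Hw_def linear_subspace_Hw_def
  proof (intro conjI ballI allI impI)
    show "(\<lambda>x'. 0) \<in> ?P"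
      by (simp add: Hw_zero almost_split_imp_tame almost_split_zero)
    show "(\<lambda>x'. f x' + g x') \<in> ?P" if "f \<in> ?P" "g \<in> ?P" for f g
      using that tame_combine[of X0 w f g 1 "\<lambda>x'. f x' + g x'"] by (simp add: Hw_add abs_triangle_ineq)
    show "(\<lambda>x'. c * f x') \<in> ?P" if "f \<in> ?P" for c f
      using that tame_combine[of X0 w f f "\<bar>c\<bar>" "\<lambda>x'. c * f x'"]
      by (simp add: Hw_scale abs_mult mult_left_mono)
    show "f \<in> ?P" if "g \<in> ?P" "f \<in> Hw" and fg: "\<forall>x'. \<bar>f x'\<bar> \<le> \<bar>g x'\<bar>" for f g
    proof -
      have "\<bar>f x'\<bar> \<le> 1 * (\<bar>g x'\<bar> + \<bar>g x'\<bar>)" for x'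
        using fg[rule_format, of x'] abs_ge_zero[of "g x'"] by simp
      then show ?thesis using that(1,2) tame_combine[of X0 w g g 1 f] by simp
    qed
  qed auto
  moreover have "FBL p \<subseteq> ?P"
  proof
    fix h :: "'a dual_fun" assume h: "h \<in> FBL p"
    then have "h \<in> Hw" by (simp add: FBL_def Hwp_closure_def Hwp_def)
    with h show "h \<in> ?P"
      by (simp add: almost_split_imp_tame almost_split_FBL[OF assms(1)])
  qed
  ultimately have "Iw p \<subseteq> ?P" unfolding Iw_def by (intro hull_minimal)
  then show ?thesis using assms(2) by blast
qed

section \<open>The two separating functions\<close>

text \<open>The approximant is the geometric mean cut off at a multiple of
  \<open>\<bar>evaluation x x'\<bar>\<close>; the part cut away is at most a small multiple of
  f.\<close>

lemma sqrt_in_Iw_closure: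
  assumes f: "f \<in> Hwp p" "\<And>x'. 0 \<le> f x'"
  shows "(\<lambda>x'. sqrt (f x' * \<bar>evaluation x x'\<bar>)) \<in> Iw_closure p" (is "?g \<in> _")
  unfolding Iw_closure_def
proof (rule Hwp_closureI[OF p])
  have f_Hw: "f \<in> Hw" using f by (simp add: Hwp_def)
  have g_Hw: "?g \<in> Hw" by (intro Hw_geometric_mean f_Hw Hw_abs evaluation_in_Hw)
  \<comment> \<open>The product of the two terms being averaged, and so their geometric mean, is
    independent of e.\<close>
  have AMGM: "\<bar>?g x'\<bar> \<le> (e * f x' + \<bar>evaluation x x'\<bar> / e) / 2" if "0 < e" for e x'
    using arith_geo_mean_sqrt[of "e * f x'" "\<bar>evaluation x x'\<bar> / e"] f(2)[of x'] that by simp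
  show "?g \<in> Hwp p"
  proof (rule HwpI_dominated[OF p g_Hw f(1) evaluation_in_Hwp[OF p, of x]])
    show "\<bar>?g x'\<bar> \<le> \<bar>f x'\<bar> + \<bar>evaluation x x'\<bar>" for x'
      using AMGM[of 1 x'] f(2)[of x'] by simp
  qed
  fix e :: real assume e: "0 < e"
  obtain C where C: "0 \<le> C" "\<And>n x'. lp_norm p n (\<lambda>i. f (x' i)) \<le> C * weak_norm p n x'"
    using f(1) unfolding Hwp_iff by blast
  \<comment> \<open>The remainder is at most d f, whose p-norm is at most d C.\<close>
  define d where "d = e / (C + 1)"
  have d: "0 < d" "d * C \<le> e" using e C(1) by (simp_all add: d_def field_simps)
  define h where "h = (\<lambda>x'. min (?g x') (1 / d * \<bar>evaluation x x'\<bar>))"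
  have "h \<in> Hw" unfolding h_def by (intro Hw_min g_Hw Hw_scale Hw_abs evaluation_in_Hw)
  then have "h \<in> Iw p"
    by (rule dominated_by_evaluation_in_Iw[OF p, where c = "1 / d" and x = x])
      (use f(2) d in \<open>simp add: h_def abs_mult\<close>)
  moreover have "lp_norm p n (\<lambda>i. ?g (x' i) - h (x' i)) \<le> e * weak_norm p n x'" for n x'
  proof -
    \<comment> \<open>Where the cut is active, subtracting
      \<open>\<bar>evaluation x y\<bar> / d\<close> from the AM-GM bound leaves at most d f /
      2.\<close>
    have "\<bar>?g y - h y\<bar> \<le> \<bar>d * f y\<bar>" for y
    proof -
      have "0 \<le> d * f y" "0 \<le> \<bar>evaluation x y\<bar> / d" using f(2) d(1) by simp_all
      then show ?thesis using AMGM[OF d(1), of y] abs_ge_self[of "?g y"]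
        by (simp add: h_def min_def)
    qed
    then have "lp_norm p n (\<lambda>i. ?g (x' i) - h (x' i)) \<le> lp_norm p n (\<lambda>i. d * f (x' i))"
      by (intro lp_norm_mono[OF p])
    also have "\<dots> \<le> d * (C * weak_norm p n x')"
      using C(2) d(1) by (simp add: lp_norm_scale[OF p])
    also have "\<dots> \<le> e * weak_norm p n x'"
      using mult_right_mono[OF d(2) weak_norm_nonneg[OF p, of n x']] by (simp add: mult.assoc)
    finally show ?thesis .
  qed
  ultimately show "\<exists>g\<in>Iw p \<inter> Hwp p. \<forall>n x'. lp_norm p n (\<lambda>i. ?g (x' i) - g (x' i)) \<le> e * weak_norm p n x'"
    using Iw_subset_Hwp[OF p] by blast
qed

lemma norm_dual_operator_in_Hwp:
  assumes "compact_operator T" "p_summing p (dual_operator T)"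
  shows "(\<lambda>x'. norm (dual_operator T x')) \<in> Hwp p"
  using p_summing_bound[OF assms(2)] norm_dual_operator_in_Hw[OF assms(1)]
  unfolding Hwp_iff by metis

text \<open>Split c into halves: one for the distance to a member g of the ideal, one for g itself
  on an annihilator. Together they contradict persistence with constant c.\<close>

lemma norm_dual_operator_notin_Iw_closure:
  assumes X0: "closure X0 = UNIV" and T: "dual_persistent_rel p X0 T"
  shows "(\<lambda>x'. norm (dual_operator T x')) \<notin> Iw_closure p"
proof
  obtain c where c: "0 < c" "\<And>F. finite F \<Longrightarrow> F \<subseteq> X0 \<Longrightarrow>
      ennreal c < pi_summing p (\<Inter>x\<in>F. annihilator x) (dual_operator T)"
    using T unfolding dual_persistent_rel_def by blast
  assume "(\<lambda>x'. norm (dual_operator T x')) \<in> Iw_closure p"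
  then obtain g where g: "g \<in> Iw p"
    "\<And>n x'. lp_norm p n (\<lambda>i. norm (dual_operator T (x' i)) - g (x' i)) \<le> c / 2 * weak_norm p n x'"
    using Hwp_closureD[OF p, of _ "Iw p" "c / 2"] c(1) unfolding Iw_closure_def by auto
  \<comment> \<open>Only families inside the annihilator are tested, so w = 0 is enough, and s = 0
    will remove the term with M.\<close>
  have "tame p X0 0 g" by (rule tame_Iw[OF X0 g(1)])
  then obtain M where "\<And>e. 0 < e \<Longrightarrow> on_annihilators X0 (\<lambda>n v s.
      lp_norm p n (\<lambda>i. g (s i *\<^sub>R 0 + v i)) \<le> e * weak_norm p n v + M * lp_norm p n s)"
    unfolding tame_def by blast
  then obtain F where F: "finite F" "F \<subseteq> X0" and g_le:
    "\<forall>n v s. (\<forall>i<n. v i \<in> (\<Inter>x\<in>F. annihilator x) \<and> 0 \<le> s i) \<longrightarrow>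
      lp_norm p n (\<lambda>i. g (s i *\<^sub>R 0 + v i)) \<le> c / 2 * weak_norm p n v + M * lp_norm p n s"
    using half_gt_zero[OF c(1)] unfolding on_annihilators_def by meson
  obtain n v where v: "\<And>i. i < n \<Longrightarrow> v i \<in> (\<Inter>x\<in>F. annihilator x)"
    "c * weak_norm p n v < lp_norm p n (\<lambda>i. norm (dual_operator T (v i)))"
    using pi_summing_greaterE[OF c(2)[OF F]] c(1) by (metis less_imp_le)
  have "lp_norm p n (\<lambda>i. g (v i)) \<le> c / 2 * weak_norm p n v"
    using g_le[rule_format, of n v "\<lambda>i. 0"] v(1) by (simp add: lq_norm_zero)
  moreover have "lp_norm p n (\<lambda>i. norm (dual_operator T (v i))) \<le>
      lp_norm p n (\<lambda>i. norm (dual_operator T (v i)) - g (v i)) + lp_norm p n (\<lambda>i. g (v i))"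
    by (rule lp_norm_le_add[OF p]) auto
  ultimately show False using g(2)[of n v] v(2) by simp
qed

lemma sqrt_notin_Iw:
  fixes w :: "'x::real_normed_vector \<Rightarrow>\<^sub>L real"
  assumes X0: "closure X0 = UNIV" and T: "dual_persistent_rel p X0 T"
    and x: "x \<in> X0" "blinfun_apply w x = 1"
  shows "(\<lambda>x'. sqrt (norm (dual_operator T x') * \<bar>evaluation x x'\<bar>)) \<notin> Iw p" (is "?f \<notin> _")
proof
  obtain c where c: "0 < c" "\<And>F. finite F \<Longrightarrow> F \<subseteq> X0 \<Longrightarrow>
      ennreal c < pi_summing p (\<Inter>x\<in>F. annihilator x) (dual_operator T)"
    using T unfolding dual_persistent_rel_def by blast
  assume "?f \<in> Iw p"
  then have "tame p X0 w ?f" by (rule tame_Iw[OF X0])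
  then obtain M where M: "0 \<le> M" "\<And>e. 0 < e \<Longrightarrow> on_annihilators X0 (\<lambda>n v s.
      lp_norm p n (\<lambda>i. ?f (s i *\<^sub>R w + v i)) \<le> e * weak_norm p n v + M * lp_norm p n s)"
    unfolding tame_def by blast
  define K where "K = norm (dual_operator T w)"
  \<comment> \<open>The condition on \<open>t * K\<close> ensures that adding
    \<open>s i *\<^sub>R w\<close> to \<open>v i\<close> destroys at most half of the norm of the
    image of \<open>v i\<close>.\<close>
  have bound: "sqrt (t / 2) \<le> (M + 1) * t" if t: "0 < t" "t * K \<le> 1 / 2" for t
  proof -
    have "0 < t * c" using t c by simp
    \<comment> \<open>Tameness is used with error t c, which makes the error term at most t A below,
      of the same order as the term with M.\<close>
    then obtain F where F: "finite F" "F \<subseteq> X0"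
      "\<forall>n v s. (\<forall>i<n. v i \<in> (\<Inter>x\<in>F. annihilator x) \<and> 0 \<le> s i) \<longrightarrow>
        lp_norm p n (\<lambda>i. ?f (s i *\<^sub>R w + v i)) \<le> t * c * weak_norm p n v + M * lp_norm p n s"
      using M(2) unfolding on_annihilators_def by meson
    \<comment> \<open>With x included, every \<open>v i\<close> vanishes at x, so evaluation at x
      reads off the coefficient \<open>s i = t * b i\<close>.\<close>
    have "finite (insert x F)" "insert x F \<subseteq> X0" using F x by auto
    then obtain n v where v: "\<And>i. i < n \<Longrightarrow> v i \<in> (\<Inter>x\<in>insert x F. annihilator x)"
      "c * weak_norm p n v < lp_norm p n (\<lambda>i. norm (dual_operator T (v i)))"
      using pi_summing_greaterE[OF c(2)] c(1) by (metis less_imp_le)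
    define b where "b i = norm (dual_operator T (v i))" for i
    define A where "A = lp_norm p n b"
    have A: "c * weak_norm p n v < A" using v(2) by (simp add: A_def b_def[abs_def])
    \<comment> \<open>The strict excess makes A positive, so that A can be cancelled at the
      end.\<close>
    have "0 \<le> c * weak_norm p n v" using c(1) weak_norm_nonneg[OF p, of n v] by simp
    then have "0 < A" using A by linarith
    have "\<bar>sqrt (t / 2) * b i\<bar> \<le> \<bar>?f ((t * b i) *\<^sub>R w + v i)\<bar>" if "i < n" for i
    proof -
      have b: "0 \<le> b i" by (simp add: b_def)
      have ev: "evaluation x ((t * b i) *\<^sub>R w + v i) = t * b i"
        using v(1)[OF that] x(2)
        by (simp add: evaluation_def annihilator_def blinfun.add_left blinfun.scaleR_left)
      have "b i \<le> norm (dual_operator T ((t * b i) *\<^sub>R w + v i)) + norm (dual_operator T ((t * b i) *\<^sub>R w))"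
        unfolding b_def by (simp add: blinfun.add_right)
          (metis add_diff_cancel_left' norm_triangle_ineq4 add.commute)
      also have "norm (dual_operator T ((t * b i) *\<^sub>R w)) = t * K * b i"
        using t b by (simp add: blinfun.scaleR_right K_def abs_mult)
      also have "\<dots> \<le> 1 / 2 * b i" by (rule mult_right_mono[OF t(2) b])
      finally have "b i / 2 \<le> norm (dual_operator T ((t * b i) *\<^sub>R w + v i))" by simp
      then have "b i / 2 * (t * b i) \<le> norm (dual_operator T ((t * b i) *\<^sub>R w + v i)) * (t * b i)"
        using t b by (intro mult_right_mono) auto
      then have "sqrt (t / 2 * (b i * b i)) \<le> ?f ((t * b i) *\<^sub>R w + v i)"
        using t b by (simp only: ev real_sqrt_le_iff) (simp add: mult_ac)
      moreover have "sqrt (t / 2 * (b i * b i)) = sqrt (t / 2) * b i"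
        using b by (simp only: real_sqrt_mult real_sqrt_mult_self abs_of_nonneg)
      moreover have "0 \<le> sqrt (t / 2) * b i" using t b by simp
      ultimately show ?thesis by linarith
    qed
    then have "sqrt (t / 2) * A \<le> lp_norm p n (\<lambda>i. ?f ((t * b i) *\<^sub>R w + v i))"
      using lp_norm_mono[OF p, of n "\<lambda>i. sqrt (t / 2) * b i" "\<lambda>i. ?f ((t * b i) *\<^sub>R w + v i)"] t
      by (simp add: lp_norm_scale[OF p] A_def)
    also have "\<dots> \<le> t * c * weak_norm p n v + M * lp_norm p n (\<lambda>i. t * b i)"
      using F(3)[rule_format, of n v "\<lambda>i. t * b i"] v(1) t(1) by (simp add: b_def)
    also have "\<dots> = t * (c * weak_norm p n v) + M * (t * A)"
      using t(1) by (simp add: lp_norm_scale[OF p] A_def)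
    also have "\<dots> \<le> t * A + M * (t * A)" using A t(1) by simp
    also have "\<dots> = (M + 1) * t * A" by (simp add: algebra_simps)
    finally show ?thesis using \<open>0 < A\<close> by simp
  qed
  \<comment> \<open>The first summand gives \<open>t * K \<le> 1 / 2\<close>; the second makes the
    squared bound read t/2 \<le> t/4.\<close>
  define t where "t = 1 / (2 * K + 4 * (M + 1)\<^sup>2)"
  have K: "0 \<le> K" by (simp add: K_def)
  have pos: "0 < 2 * K + 4 * (M + 1)\<^sup>2" using K M(1) by (intro add_nonneg_pos) auto
  have t: "0 < t" "t * K \<le> 1 / 2" "(M + 1)\<^sup>2 * t \<le> 1 / 4"
    using pos K by (simp_all add: t_def field_simps)
  have "t / 2 \<le> ((M + 1) * t)\<^sup>2" using bound[OF t(1,2)] by (rule sqrt_le_D)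
  also have "\<dots> = (M + 1)\<^sup>2 * t * t" by (simp add: power2_eq_square mult_ac)
  also have "\<dots> \<le> 1 / 4 * t" using t by (intro mult_right_mono) auto
  finally show False using t(1) by simp
qed

text \<open>Persistence with no annihilation conditions provides a family on which the adjoint
  cannot vanish.\<close>

lemma dual_persistent_rel_imp_nonzero:
  assumes "dual_persistent_rel p X0 T"
  obtains v where "dual_operator T v \<noteq> 0"
proof (rule ccontr)
  assume "\<not> thesis"
  then have T0: "dual_operator T v = 0" for v using that by blast
  obtain c where c: "0 < c" "ennreal c < pi_summing p UNIV (dual_operator T)"
    using assms unfolding dual_persistent_rel_def by (metis INT_empty empty_subsetI finite.emptyI)
  obtain n v where "c * weak_norm p n v < lp_norm p n (\<lambda>i. norm (dual_operator T (v i)))"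
    using pi_summing_greaterE[OF c(2)] c(1) by (metis less_imp_le)
  then show False
    using c(1) weak_norm_nonneg[OF p, of n v] by (simp add: T0 lq_norm_zero mult_less_0_iff)
qed

end

theorem theorem5p10:
  fixes p :: real
  assumes "1 \<le> p"
    and "\<exists>T :: 'z::banach \<Rightarrow>\<^sub>L 'x::banach.
           compact_operator T \<and> dual_persistent p T \<and> p_summing p (dual_operator T)"
  shows "(Iw_closure p :: 'x dual_fun set) \<subset> Hwp p \<and>
         (Iw p :: 'x dual_fun set) \<subset> Iw_closure p"
proof -
  note p = assms(1)
  obtain T :: "'z \<Rightarrow>\<^sub>L 'x" and X0 where T: "compact_operator T" "p_summing p (dual_operator T)"
    and X0: "closure X0 = UNIV" "dual_persistent_rel p X0 T"
    using assms(2) unfolding dual_persistent_def by blast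
  let ?f = "\<lambda>x'. norm (dual_operator T x')"
  have f: "?f \<in> Hwp p" by (rule norm_dual_operator_in_Hwp[OF p T])
  have "Iw_closure p \<subseteq> (Hwp p :: 'x dual_fun set)"
    by (auto simp: Iw_closure_def Hwp_closure_def)
  then have "(Iw_closure p :: 'x dual_fun set) \<subset> Hwp p"
    using f norm_dual_operator_notin_Iw_closure[OF p X0] by blast
  moreover
  obtain v where v: "dual_operator T v \<noteq> 0"
    using dual_persistent_rel_imp_nonzero[OF p X0(2)] by blast
  \<comment> \<open>The kernel of v is closed, so if it contained the dense set \<open>X0\<close>, v
    would be 0.\<close>
  obtain x where x: "x \<in> X0" "v x \<noteq> 0"
  proof (rule ccontr)
    assume "\<not> thesis"
    then have "X0 \<subseteq> {x. v x = 0}" using that by blast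
    moreover have "closed {x. v x = 0}" by (intro closed_Collect_eq continuous_intros)
    ultimately have "v x = 0" for x using closure_minimal X0(1) by blast
    then have "v = 0" by (intro blinfun_eqI) simp
    then show False using v by simp
  qed
  \<comment> \<open>This multiple of v is the fixed direction w for the second separation.\<close>
  then have "blinfun_apply (v /\<^sub>R v x) x = 1" by (simp add: blinfun.scaleR_left)
  from sqrt_notin_Iw[OF p X0 x(1) this] sqrt_in_Iw_closure[OF p f, of x]
    Hwp_closure_superset[OF p Iw_subset_Hwp[OF p]]
  have "(Iw p :: 'x dual_fun set) \<subset> Iw_closure p"
    unfolding Iw_closure_def by auto
  ultimately show ?thesis by blast
qed

end
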